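(* There exist $n,m,\ell\in\mathbb{N}$ with $n\le m$ and $\ell<nm$, a linear operator $\mathcal{L}:\mathbb{R}^{n\times m}\to\mathbb{R}^\ell$ and a vector $y\in\mathrm{image}(\mathcal{L})$ such that there exists a sequence $\{X^{(k)}\}_{k=1}^\infty\subset\mathcal{L}^{-1}(y)$ with $$\lim_{k\to\infty}\sigma_r(X^{(k)})=0,\quad\text{even though}\quad r=\min_{X\in\mathcal{L}^{-1}(y)}\mathrm{rank}(X).$$
   Context: $\mathcal{L}^{-1}(y)=\{X\in\mathbb{R}^{n\times m}\mid\mathcal{L}(X)=y\}$, and $\sigma_1(X)\ge\sigma_2(X)\ge\dots\ge\sigma_n(X)\ge 0$ denote the singular values of $X$ in decreasing order. *)

theory Defs
  imports
    Complex_Main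
    "Jordan_Normal_Form.Char_Poly"
    "Jordan_Normal_Form.DL_Rank"
begin

text \<open>
  The dimensions are existentially quantified in the statement, so \<open>\<real>\<close>-matrices and vectors are those of
  \<^theory>\<open>Jordan_Normal_Form.Matrix\<close>, with carriers \<^term>\<open>carrier_mat n m\<close> and \<^term>\<open>carrier_vec l\<close>.
\<close>

definition linear_operator :: "nat \<Rightarrow> nat \<Rightarrow> nat \<Rightarrow> (real mat \<Rightarrow> real vec) \<Rightarrow> bool" where
  "linear_operator n m l L \<longleftrightarrow>
     linear_map class_ring (module_mat TYPE(real) n m) (module_vec TYPE(real) l) L"

definition fiber :: "nat \<Rightarrow> nat \<Rightarrow> (real mat \<Rightarrow> real vec) \<Rightarrow> real vec \<Rightarrow> real mat set" where
  "fiber n m L y = {X \<in> carrier_mat n m. L X = y}"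

definition mat_rank :: "real mat \<Rightarrow> nat" where
  "mat_rank X = vec_space.rank (dim_row X) X"

text \<open>
  The singular values of an \<open>n \<times> m\<close> matrix \<open>X\<close> with \<open>n \<le> m\<close> are the square roots of the \<open>n\<close> eigenvalues
  of the symmetric positive semidefinite matrix \<open>X X\<^sup>T\<close>, counted with multiplicity. The characteristic
  polynomial of \<open>X X\<^sup>T\<close> splits over the reals, so the list below has length \<open>n\<close>.
\<close>

definition singular_values :: "real mat \<Rightarrow> real list" where
  "singular_values X =
     rev (sorted_list_of_multiset (image_mset sqrt (proots (char_poly (X * transpose_mat X)))))"

text \<open>The index starts at 1: \<open>singular_value 1 X\<close> is the largest and \<open>singular_value n X\<close> the smallest one.
  The value is only meaningful for \<open>1 \<le> i \<le> n\<close>.\<close>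

definition singular_value :: "nat \<Rightarrow> real mat \<Rightarrow> real" where
  "singular_value i X = singular_values X ! (i - 1)"

end

theory Submission
  imports Defs
begin

text \<open>
  The rank is not robust at infinity: the determinant of a square matrix can stay fixed while the
  smallest singular value tends to 0, as long as the largest one escapes to infinity. The shear
  matrices with rows \<open>(1, x)\<close> and \<open>(0, 1)\<close>, where \<open>x\<close> ranges over the reals, form an affine line of
  \<open>2 \<times> 2\<close> matrices, namely the fiber over \<open>(1, 0, 1)\<close> of the operator that reads off all entries
  except the upper right one. They all have determinant 1, hence rank 2, so the minimal rank
  on the fiber is \<open>r = 2\<close>. The product of the two singular values of a shear is 1 as well, and
  for \<open>x = s - 1/s\<close> with \<open>s \<ge> 1\<close> they are exactly \<open>s\<close> and \<open>1/s\<close>. Letting \<open>s \<rightarrow> \<infinity>\<close> gives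
  \<open>\<sigma>\<^sub>2 = 1/s \<rightarrow> 0\<close>. (With \<open>r = 1\<close> no example exists: \<open>\<sigma>\<^sub>1(X\<^sub>k) \<rightarrow> 0\<close> means \<open>X\<^sub>k \<rightarrow> 0\<close>, and then
  the closed fiber contains the zero matrix.)
\<close>

section \<open>Two by two matrices\<close>

lemma det_mat_2:
  fixes A :: "'a::comm_ring_1 mat"
  assumes "A \<in> carrier_mat 2 2"
  shows "det A = A $$ (0,0) * A $$ (1,1) - A $$ (0,1) * A $$ (1,0)"
proof -
  have minor: "det (mat_delete A i 0) = mat_delete A i 0 $$ (0,0)" for i
    using assms by (intro det_single carrier_matI) simp_all
  have "det A = (\<Sum>i<2. A $$ (i,0) * cofactor A i 0)"
    using assms by (rule laplace_expansion_column) simp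
  also have "\<dots> = A $$ (0,0) * A $$ (1,1) - A $$ (0,1) * A $$ (1,0)"
    using assms by (simp add: numeral_2_eq_2 cofactor_def minor) (simp add: mat_delete_def)
  finally show ?thesis .
qed

lemma char_poly_mat_2:
  fixes A :: "'a::field mat"
  assumes "A \<in> carrier_mat 2 2"
  shows "char_poly A = [:det A, - (A $$ (0,0) + A $$ (1,1)), 1:]"
proof -
  have "char_poly_matrix A \<in> carrier_mat 2 2"
    using assms by simp
  then show ?thesis
    using assms by (simp add: char_poly_def det_mat_2 char_poly_matrix_def)
qed

section \<open>The fiber of shears\<close>

definition shear :: "real \<Rightarrow> real mat" where
  "shear x = mat_of_rows_list 2 [[1, x], [0, 1]]"

definition forget_upper_right :: "real mat \<Rightarrow> real vec" where
  "forget_upper_right X = vec 3 (\<lambda>i. X $$ ([(0,0), (1,0), (1,1)] ! i))"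

lemma shear_carrier [simp]: "shear x \<in> carrier_mat 2 2"
  by (intro carrier_matI) (simp_all add: shear_def mat_of_rows_list_def)

lemma linear_operator_forget_upper_right: "linear_operator 2 2 3 forget_upper_right"
proof -
  interpret V: vectorspace class_ring "module_mat TYPE(real) 2 2"
    by (rule matrix_vs)
  interpret W: vectorspace class_ring "module_vec TYPE(real) 3"
    by (rule vec_vs)
  have "i = 0 \<or> i = 1 \<or> i = 2" if "i < 3" for i :: nat
    using that by linarith
  then have "forget_upper_right \<in>
      module_hom class_ring (module_mat TYPE(real) 2 2) (module_vec TYPE(real) 3)"
    by (auto simp: module_hom_def module_vec_simps module_mat_simps forget_upper_right_def
        intro!: eq_vecI) (force simp: nth_Cons')+
  then show ?thesis
    unfolding linear_operator_def by unfold_locales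
qed

lemma fiber_forget_upper_right:
  assumes "X \<in> fiber 2 2 forget_upper_right (forget_upper_right (1\<^sub>m 2))"
  shows "X $$ (0,0) = 1" "X $$ (1,0) = 0" "X $$ (1,1) = 1"
proof -
  have "forget_upper_right X $ i = forget_upper_right (1\<^sub>m 2) $ i" for i
    using assms by (simp add: fiber_def)
  from this[of 0] this[of 1] this[of 2]
  show "X $$ (0,0) = 1" "X $$ (1,0) = 0" "X $$ (1,1) = 1"
    by (simp_all add: forget_upper_right_def)
qed

lemma shear_in_fiber: "shear x \<in> fiber 2 2 forget_upper_right (forget_upper_right (1\<^sub>m 2))"
  by (auto simp: fiber_def shear_def forget_upper_right_def mat_of_rows_list_def less_Suc_eq
      numeral_3_eq_3 intro!: eq_vecI)

text \<open>Every matrix in the fiber is unitriangular, so its determinant cannot vanish.\<close>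

lemma mat_rank_fiber:
  assumes "X \<in> fiber 2 2 forget_upper_right (forget_upper_right (1\<^sub>m 2))"
  shows "mat_rank X = 2"
proof -
  have X: "X \<in> carrier_mat 2 2"
    using assms by (simp add: fiber_def)
  have "det X = 1"
    using fiber_forget_upper_right[OF assms] by (simp add: det_mat_2[OF X])
  then show ?thesis
    using vec_space.det_rank_iff[OF X] X by (simp add: mat_rank_def)
qed

section \<open>Singular values of shears\<close>

text \<open>
  The product of a shear with its transpose has determinant 1 and trace \<open>2 + x\<^sup>2\<close>. Writing its eigenvalues as
  \<open>s\<^sup>2\<close> and \<open>1/s\<^sup>2\<close>, the trace condition reads \<open>x\<^sup>2 = (s - 1/s)\<^sup>2\<close>, which explains the choice of \<open>x\<close>.
\<close>

lemma singular_values_shear: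
  assumes "1 \<le> s"
  shows "singular_values (shear (s - 1/s)) = [s, 1/s]"
proof -
  define x where "x = s - 1/s"
  define G where "G = shear x * transpose_mat (shear x)"
  have G: "G \<in> carrier_mat 2 2"
    by (auto simp: G_def intro!: mult_carrier_mat[of _ 2 2 _ 2])
  have entries: "G $$ (0,0) = 1 + x\<^sup>2" "G $$ (0,1) = x" "G $$ (1,0) = x" "G $$ (1,1) = 1"
    by (simp_all add: G_def shear_def mat_of_rows_list_def scalar_prod_def numeral_2_eq_2)
  have trace: "2 + x\<^sup>2 = s\<^sup>2 + (1/s)\<^sup>2"
    using assms by (simp add: x_def power2_diff)
  have "char_poly G = [:- (s\<^sup>2), 1:] * [:- ((1/s)\<^sup>2), 1:]"
    using assms trace by (simp add: char_poly_mat_2[OF G] det_mat_2[OF G] entries power2_eq_square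
        del: One_nat_def)
  \<comment> \<open>The product has to stay factored for the roots to be read off.\<close>
  then have "proots (char_poly G) = {#s\<^sup>2, (1/s)\<^sup>2#}"
    by (simp add: proots_mult del: mult_pCons_left mult_pCons_right)
  then have "image_mset sqrt (proots (char_poly G)) = mset [1/s, s]"
    using assms by simp
  moreover have "sorted [1/s, s]"
    using assms order_trans[of "1/s" 1 s] by simp
  ultimately have "sorted_list_of_multiset (image_mset sqrt (proots (char_poly G))) = [1/s, s]"
    by (simp only: sorted_list_of_multiset_mset sorted_sort_id)
  then show ?thesis
    by (simp add: singular_values_def G_def x_def)
qed

theorem proposition1p3:
  shows "\<exists>(n::nat) (m::nat) (l::nat) (L :: real mat \<Rightarrow> real vec) (y :: real vec) (r::nat).
    n \<le> m \<and> l < n * m \<and>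
    linear_operator n m l L \<and>
    y \<in> L ` carrier_mat n m \<and>
    r = (LEAST k. k \<in> mat_rank ` fiber n m L y) \<and> 1 \<le> r \<and>
    (\<exists>X :: nat \<Rightarrow> real mat.
       (\<forall>k\<ge>1. X k \<in> fiber n m L y) \<and>
       (\<lambda>k. singular_value r (X k)) \<longlonglongrightarrow> 0)"
proof -
  define y where "y = forget_upper_right (1\<^sub>m 2)"
  define X where "X k = shear (real k - 1 / real k)" for k
  have "mat_rank ` fiber 2 2 forget_upper_right y = {2}"
    using shear_in_fiber[of 0] by (force simp: y_def mat_rank_fiber)
  then have rank: "2 = (LEAST k. k \<in> mat_rank ` fiber 2 2 forget_upper_right y)"
    by (simp add: Least_equality)
  have "singular_value 2 (X k) = 1 / real k" if "1 \<le> k" for k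
    using that by (simp add: singular_value_def X_def singular_values_shear)
  then have "(\<lambda>k. singular_value 2 (X k)) \<longlonglongrightarrow> 0"
    using Lim_transform_eventually[OF lim_1_over_n]
    by (metis (mono_tags, lifting) eventually_sequentiallyI)
  moreover have "\<forall>k\<ge>1. X k \<in> fiber 2 2 forget_upper_right y"
    by (simp add: X_def y_def shear_in_fiber)
  moreover have "y \<in> forget_upper_right ` carrier_mat 2 2"
    by (simp add: y_def)
  ultimately show ?thesis
    using linear_operator_forget_upper_right rank
    by (intro exI[of _ 2] exI[of _ 3] exI[of _ forget_upper_right] exI[of _ y]) auto
qed

end
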